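(* Let $G$ be a connected graph with minimum degree $\delta(G) \ge 3$ and let $D \subseteq V(G)$ be a connected 3-dominating set of $G$. Then $rx_3(G) \le rx_3(G[D]) + 3$. Moreover, the bound is tight: there exist a connected graph $G$ with $\delta(G) \ge 3$ and a connected 3-dominating set $D$ of $G$ such that $rx_3(G) = rx_3(G[D]) + 3$.
   Context: All graphs are undirected, finite and simple. An edge-coloring of a graph assigns a color to each edge; adjacent edges may receive the same color. A tree (subgraph) in an edge-colored graph is rainbow if no two of its edges have the same color. An edge-coloring of a connected graph $H$ is a 3-rainbow coloring if for every set $S$ of three vertices of $H$ there is a rainbow tree in $H$ whose vertex set contains $S$. The 3-rainbow index $rx_3(H)$ is the minimum number of colors in a 3-rainbow coloring of $H$. $G[D]$ denotes the subgraph of $G$ induced by $D$. A set $D \subseteq V(G)$ is a 3-dominating set of $G$ if every vertex of $V(G)\setminus D$ is adjacent to at least $3$ distinct vertices of $D$; it is a connected 3-dominating set if in addition $G[D]$ is connected. *)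

theory Defs
  imports Main
begin

record 'a ugraph =
  verts :: "'a set"
  edges :: "'a set set"

definition simple_graph :: "'a ugraph \<Rightarrow> bool" where
  "simple_graph G \<longleftrightarrow> finite (verts G) \<and> (\<forall>e \<in> edges G. e \<subseteq> verts G \<and> card e = 2)"

definition subgraph_of :: "'a ugraph \<Rightarrow> 'a ugraph \<Rightarrow> bool" where
  "subgraph_of H G \<longleftrightarrow> simple_graph H \<and> verts H \<subseteq> verts G \<and> edges H \<subseteq> edges G"

definition induced_graph :: "'a ugraph \<Rightarrow> 'a set \<Rightarrow> 'a ugraph" where
  "induced_graph G D = \<lparr>verts = D, edges = {e \<in> edges G. e \<subseteq> D}\<rparr>"

definition adj_rel :: "'a ugraph \<Rightarrow> ('a \<times> 'a) set" where
  "adj_rel G = {(u, v). {u, v} \<in> edges G}"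

(* Convention: a connected graph has at least one vertex. *)
definition connected_graph :: "'a ugraph \<Rightarrow> bool" where
  "connected_graph G \<longleftrightarrow>
     simple_graph G \<and> verts G \<noteq> {} \<and> (\<forall>u \<in> verts G. \<forall>v \<in> verts G. (u, v) \<in> (adj_rel G)\<^sup>*)"

(* A cycle is the list of its (pairwise distinct) vertices in cyclic order. *)
definition is_cycle :: "'a ugraph \<Rightarrow> 'a list \<Rightarrow> bool" where
  "is_cycle G p \<longleftrightarrow> length p \<ge> 3 \<and> distinct p \<and>
     (\<forall>i < length p. {p ! i, p ! (Suc i mod length p)} \<in> edges G)"

definition tree_graph :: "'a ugraph \<Rightarrow> bool" where
  "tree_graph T \<longleftrightarrow> connected_graph T \<and> (\<nexists>p. is_cycle T p)"

definition vertex_degree :: "'a ugraph \<Rightarrow> 'a \<Rightarrow> nat" where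
  "vertex_degree G v = card {e \<in> edges G. v \<in> e}"

definition min_degree :: "'a ugraph \<Rightarrow> nat" where
  "min_degree G = Min (vertex_degree G ` verts G)"

definition rainbow_tree_in :: "'a ugraph \<Rightarrow> ('a set \<Rightarrow> nat) \<Rightarrow> 'a ugraph \<Rightarrow> bool" where
  "rainbow_tree_in H c T \<longleftrightarrow> subgraph_of T H \<and> tree_graph T \<and> inj_on c (edges T)"

definition rainbow3_coloring :: "'a ugraph \<Rightarrow> ('a set \<Rightarrow> nat) \<Rightarrow> bool" where
  "rainbow3_coloring H c \<longleftrightarrow>
     (\<forall>S. S \<subseteq> verts H \<and> card S = 3 \<longrightarrow> (\<exists>T. rainbow_tree_in H c T \<and> S \<subseteq> verts T))"

(* Meaningful for connected H: an injective coloring is then a 3-rainbow coloring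
   (take a spanning tree), so LEAST ranges over a nonempty set.  As H is finite,
   taking colors in nat is no restriction; only colors actually used on edges of H
   are counted. *)
definition rx3 :: "'a ugraph \<Rightarrow> nat" where
  "rx3 H = (LEAST k. \<exists>c. rainbow3_coloring H c \<and> card (c ` edges H) = k)"

definition dominating3 :: "'a ugraph \<Rightarrow> 'a set \<Rightarrow> bool" where
  "dominating3 G D \<longleftrightarrow>
     D \<subseteq> verts G \<and> (\<forall>v \<in> verts G - D. card {u \<in> D. {u, v} \<in> edges G} \<ge> 3)"

definition connected_dominating3 :: "'a ugraph \<Rightarrow> 'a set \<Rightarrow> bool" where
  "connected_dominating3 G D \<longleftrightarrow> dominating3 G D \<and> connected_graph (induced_graph G D)"

end

theory Submission
  imports Defs
begin

text \<open>
  Upper bound: give every vertex \<open>v\<close> outside \<open>D\<close> three legs into \<open>D\<close>, coloured with three new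
  colours. Given three vertices, let the \<open>i\<close>-th one, if it lies outside \<open>D\<close>, descend to \<open>D\<close> along
  its leg of the \<open>i\<close>-th new colour; a rainbow tree of \<open>G[D]\<close> through the three feet, with these legs
  attached as leaves, is rainbow.

  Tightness: join a triangle \<open>D\<close> to 129 independent vertices. If at most four colours were used,
  three independent vertices would see the triangle with the same colours \<open>(a, b, c)\<close>, as
  \<open>129 > 2 * 4^3\<close>. In a rainbow tree through them they need edges to three different vertices of
  \<open>D\<close>, so the tree has at least six vertices, hence at least five edges of different colours.
\<close>

section \<open>Growing trees by leaves\<close>

lemma adj_rel_rtrancl_sym:
  assumes "(u, v) \<in> (adj_rel G)\<^sup>*"
  shows "(v, u) \<in> (adj_rel G)\<^sup>*"
proof -
  have "sym (adj_rel G)"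
    by (auto simp: sym_def adj_rel_def insert_commute)
  then show ?thesis
    using assms by (meson sym_rtrancl symD)
qed

text \<open>\<open>adj_rel\<close> is symmetric, so any two vertices are joined by a walk through
  the root \<open>r\<close>.\<close>

lemma connected_graphI_root:
  assumes "simple_graph G" and "r \<in> verts G"
    and "\<And>v. v \<in> verts G \<Longrightarrow> (r, v) \<in> (adj_rel G)\<^sup>*"
  shows "connected_graph G"
  unfolding connected_graph_def
  using assms by (blast intro: adj_rel_rtrancl_sym rtrancl_trans)

lemma finite_edges: "simple_graph G \<Longrightarrow> finite (edges G)"
  by (rule finite_subset[of _ "Pow (verts G)"]) (auto simp: simple_graph_def)

text \<open>\<open>u\<close> is the attachment point and \<open>v\<close> the new vertex. That
  \<open>u\<close> lies in \<open>T\<close> and \<open>v\<close> does not is left to the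
  lemmas.\<close>

definition add_leaf :: "'a ugraph \<Rightarrow> 'a \<Rightarrow> 'a \<Rightarrow> 'a ugraph" where
  "add_leaf T u v = \<lparr>verts = insert v (verts T), edges = insert {u, v} (edges T)\<rparr>"

lemma verts_add_leaf [simp]: "verts (add_leaf T u v) = insert v (verts T)"
  and edges_add_leaf [simp]: "edges (add_leaf T u v) = insert {u, v} (edges T)"
  by (simp_all add: add_leaf_def)

lemma simple_add_leaf:
  assumes "simple_graph T" and "u \<in> verts T" and "v \<notin> verts T"
  shows "simple_graph (add_leaf T u v)"
proof -
  have "u \<noteq> v"
    using assms by blast
  then show ?thesis
    using assms by (auto simp: simple_graph_def)
qed

lemma connected_add_leaf:
  assumes "connected_graph T" and u: "u \<in> verts T" and "v \<notin> verts T"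
  shows "connected_graph (add_leaf T u v)"
proof (rule connected_graphI_root)
  show "simple_graph (add_leaf T u v)"
    using assms by (simp add: simple_add_leaf connected_graph_def)
  show "u \<in> verts (add_leaf T u v)"
    using u by simp
  fix w assume w: "w \<in> verts (add_leaf T u v)"
  have sub: "adj_rel T \<subseteq> adj_rel (add_leaf T u v)"
    by (auto simp: adj_rel_def)
  show "(u, w) \<in> (adj_rel (add_leaf T u v))\<^sup>*"
  proof (cases "w = v")
    case True
    then show ?thesis
      by (auto simp: adj_rel_def)
  next
    case False
    then have "(u, w) \<in> (adj_rel T)\<^sup>*"
      using assms w by (auto simp: connected_graph_def)
    then show ?thesis
      using rtrancl_mono[OF sub] by blast
  qed
qed

text \<open>On a cycle each vertex has two distinct neighbours, whereas the only neighbour of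
  \<open>v\<close> is \<open>u\<close>. So a cycle must avoid \<open>v\<close>, and then it already
  lies in \<open>T\<close>.\<close>

lemma acyclic_add_leaf:
  assumes simple: "simple_graph T" and u: "u \<in> verts T" and v: "v \<notin> verts T"
    and acyc: "\<nexists>p. is_cycle T p"
  shows "\<nexists>p. is_cycle (add_leaf T u v) p"
proof
  assume "\<exists>p. is_cycle (add_leaf T u v) p"
  then obtain p where cyc: "is_cycle (add_leaf T u v) p" ..
  define n where "n = length p"
  have n: "n \<ge> 3" and dist: "distinct p"
    and edge: "\<And>i. i < n \<Longrightarrow> {p ! i, p ! (Suc i mod n)} \<in> insert {u, v} (edges T)"
    using cyc by (auto simp: is_cycle_def n_def)
  have nov: "v \<notin> e" if "e \<in> edges T" for e
    using that simple v by (auto simp: simple_graph_def)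
  have uv: "u \<noteq> v"
    using u v by blast
  have only: "w = u" if "{v, w} \<in> insert {u, v} (edges T)" for w
    using that nov[of "{v, w}"] uv by (auto simp: doubleton_eq_iff)
  show False
  proof (cases "v \<in> set p")
    case False
    have "is_cycle T p"
      unfolding is_cycle_def
    proof (intro conjI allI impI)
      fix i assume i: "i < length p"
      then have "i < length p" "Suc i mod n < length p"
        using n by (simp, unfold n_def, intro mod_less_divisor) linarith
      then have "p ! i \<in> set p" "p ! (Suc i mod n) \<in> set p"
        by simp_all
      then have "{p ! i, p ! (Suc i mod n)} \<noteq> {u, v}"
        using False by (auto simp: doubleton_eq_iff)
      then show "{p ! i, p ! (Suc i mod length p)} \<in> edges T"
        using edge[of i] i by (simp add: n_def)
    qed (use n dist in \<open>auto simp: n_def\<close>)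
    then show False
      using acyc by blast
  next
    case True
    then obtain j where j: "j < n" "p ! j = v"
      by (auto simp: in_set_conv_nth n_def)
    \<comment> \<open>\<open>s\<close> and \<open>i\<close> are the cyclic successor and predecessor
      of position \<open>j\<close>. They differ because \<open>n\<close> is at least 3, yet both
      carry the vertex \<open>u\<close>, against distinctness of \<open>p\<close>.\<close>
    define s where "s = (if Suc j = n then 0 else Suc j)"
    define i where "i = (if j = 0 then n - 1 else j - 1)"
    have bounds: "s < n" "i < n" and "s \<noteq> i"
      using j n by (auto simp: s_def i_def split: if_splits)
    have s: "Suc j mod n = s" and i: "Suc i mod n = j"
      using j n by (auto simp: s_def i_def)
    have "p ! s = u"
      using only edge[of j] j s by simp
    moreover have "p ! i = u"
      using only edge[of i] j i bounds by (simp add: insert_commute)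
    ultimately show False
      using dist bounds \<open>s \<noteq> i\<close> nth_eq_iff_index_eq[of p s i] by (simp add: n_def)
  qed
qed

lemma tree_add_leaf:
  assumes "tree_graph T" and "u \<in> verts T" and "v \<notin> verts T"
  shows "tree_graph (add_leaf T u v)"
proof -
  have conn: "connected_graph T" and acyc: "\<nexists>p. is_cycle T p"
    using assms(1) by (simp_all add: tree_graph_def)
  then have "simple_graph T"
    by (simp add: connected_graph_def)
  then show ?thesis
    using connected_add_leaf[OF conn assms(2,3)] acyclic_add_leaf[OF _ assms(2,3) acyc]
    by (simp add: tree_graph_def)
qed

lemma tree_singleton: "tree_graph \<lparr>verts = {r}, edges = {}\<rparr>"
proof -
  have "\<not> is_cycle \<lparr>verts = {r}, edges = {}\<rparr> p" for p
    by (cases p) (auto simp: is_cycle_def)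
  then show ?thesis
    by (simp add: tree_graph_def connected_graph_def simple_graph_def)
qed

section \<open>Spanning trees and the number of edges of a connected graph\<close>

lemma edge_leaving:
  assumes "(r, w) \<in> (adj_rel G)\<^sup>*" and "r \<in> A" and "w \<notin> A"
  shows "\<exists>u v. u \<in> A \<and> v \<notin> A \<and> {u, v} \<in> edges G"
  using assms
  by (induction rule: rtrancl_induct) (auto simp: adj_rel_def)

text \<open>A subtree of \<open>G\<close> with the most vertices must span: otherwise some edge of
  \<open>G\<close> leaves it, and its far end could be added as a leaf. The edge count is part of
  the maximised property \<open>P\<close>, since a leaf adds one vertex and one edge.\<close>

lemma spanning_tree:
  assumes conn: "connected_graph G"
  obtains T where "subgraph_of T G" and "tree_graph T" and "verts T = verts G"
    and "card (verts T) = Suc (card (edges T))"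
proof -
  have simple: "simple_graph G" and fin: "finite (verts G)"
    using conn by (auto simp: connected_graph_def simple_graph_def)
  define P where "P T \<longleftrightarrow> subgraph_of T G \<and> tree_graph T \<and>
    card (verts T) = Suc (card (edges T))" for T
  obtain r where r: "r \<in> verts G"
    using conn by (auto simp: connected_graph_def)
  have "P \<lparr>verts = {r}, edges = {}\<rparr>"
    using r tree_singleton[of r] by (simp add: P_def subgraph_of_def simple_graph_def)
  moreover have "\<forall>T. P T \<longrightarrow> card (verts T) \<le> card (verts G)"
    using fin by (meson P_def subgraph_of_def card_mono)
  \<comment> \<open>The one-vertex tree satisfies \<open>P\<close>, and the vertex counts are
    bounded by that of \<open>G\<close>, so a maximum exists.\<close>
  ultimately have "\<exists>T. P T \<and> (\<forall>T'. P T' \<longrightarrow> card (verts T') \<le> card (verts T))"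
    by (intro ex_has_greatest_nat[where b = "Suc (card (verts G))"]) (auto simp: less_Suc_eq_le)
  then obtain T where T: "P T"
    and maxT: "\<And>T'. P T' \<Longrightarrow> card (verts T') \<le> card (verts T)"
    by blast
  have sub: "verts T \<subseteq> verts G" "edges T \<subseteq> edges G" and sT: "simple_graph T"
    and tree: "tree_graph T" and cT: "card (verts T) = Suc (card (edges T))"
    using T by (auto simp: P_def subgraph_of_def)
  have "verts T = verts G"
  proof (rule ccontr)
    assume "verts T \<noteq> verts G"
    then obtain w where w: "w \<in> verts G" "w \<notin> verts T"
      using sub by blast
    obtain t where t: "t \<in> verts T"
      using tree by (auto simp: tree_graph_def connected_graph_def)
    have "(t, w) \<in> (adj_rel G)\<^sup>*"
      using conn t w sub by (auto simp: connected_graph_def)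
    then obtain u v where uv: "u \<in> verts T" "v \<notin> verts T" "{u, v} \<in> edges G"
      using edge_leaving t w(2) by metis
    have "v \<in> verts G"
      using simple uv(3) by (auto simp: simple_graph_def)
    have new: "{u, v} \<notin> edges T"
      using sT uv(2) by (auto simp: simple_graph_def)
    have "finite (verts T)"
      using sT by (simp add: simple_graph_def)
    then have cv: "card (verts (add_leaf T u v)) = Suc (card (verts T))"
      using uv(2) by simp
    have ce: "card (edges (add_leaf T u v)) = Suc (card (edges T))"
      using new finite_edges[OF sT] by simp
    have "P (add_leaf T u v)"
      unfolding P_def subgraph_of_def
      using sub uv cv ce cT \<open>v \<in> verts G\<close> simple_add_leaf[OF sT uv(1,2)]
        tree_add_leaf[OF tree uv(1,2)] by simp
    then show False
      using maxT cv by fastforce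
  qed
  then show thesis
    using that T by (auto simp: P_def)
qed

text \<open>The edges of a spanning tree alone reach this number. The bound later forces a rainbow
  tree with many vertices to use many colours.\<close>

lemma connected_card_le:
  assumes "connected_graph G"
  shows "card (verts G) \<le> Suc (card (edges G))"
proof -
  obtain T where T: "subgraph_of T G" "verts T = verts G"
    "card (verts T) = Suc (card (edges T))"
    using spanning_tree[OF assms] by metis
  moreover have "card (edges T) \<le> card (edges G)"
    using T(1) assms
    by (intro card_mono) (simp_all add: subgraph_of_def connected_graph_def finite_edges)
  ultimately show ?thesis
    by simp
qed

section \<open>Rainbow colourings\<close>

lemma rx3_le: "rainbow3_coloring H c \<Longrightarrow> rx3 H \<le> card (c ` edges H)"
  unfolding rx3_def by (rule Least_le) blast

text \<open>An injective colouring makes a spanning tree rainbow, and this one tree serves every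
  3-set. So \<open>LEAST\<close> ranges over a nonempty set and its value is attained.\<close>

lemma rx3_attained:
  assumes conn: "connected_graph H"
  obtains c where "rainbow3_coloring H c" and "card (c ` edges H) = rx3 H"
proof -
  obtain T where T: "subgraph_of T H" "tree_graph T" "verts T = verts H"
    using spanning_tree[OF conn] by metis
  have "finite (edges H)"
    using conn by (simp add: connected_graph_def finite_edges)
  then obtain c :: "'a set \<Rightarrow> nat" where c: "inj_on c (edges H)"
    using finite_imp_inj_to_nat_seg by metis
  then have "inj_on c (edges T)"
    using T(1) by (auto simp: subgraph_of_def intro: inj_on_subset)
  then have "rainbow3_coloring H c"
    using T unfolding rainbow3_coloring_def rainbow_tree_in_def by metis
  then have "\<exists>k c. rainbow3_coloring H c \<and> card (c ` edges H) = k"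
    by blast
  then have "\<exists>c. rainbow3_coloring H c \<and> card (c ` edges H) = rx3 H"
    unfolding rx3_def by (rule LeastI_ex)
  then show thesis
    using that by blast
qed

text \<open>If \<open>v\<close> is already in \<open>T\<close>, then \<open>T\<close> itself serves;
  otherwise \<open>v\<close> becomes a leaf. The inclusions in the conclusion cover both cases, so a
  caller need not know whether the tree has met \<open>v\<close> before.\<close>

lemma rainbow_tree_extend:
  assumes T: "rainbow_tree_in G c T" and u: "u \<in> verts T" and v: "v \<in> verts G"
    and e: "{u, v} \<in> edges G" and new: "c {u, v} \<notin> c ` edges T"
  obtains T' where "rainbow_tree_in G c T'" and "insert v (verts T) \<subseteq> verts T'"
    and "c ` edges T' \<subseteq> insert (c {u, v}) (c ` edges T)"
proof (cases "v \<in> verts T")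
  case True
  then show thesis
    using that[of T] T by blast
next
  case False
  have "rainbow_tree_in G c (add_leaf T u v)"
    using T u v e new False simple_add_leaf[of T u v] tree_add_leaf[of T u v]
    by (auto simp: rainbow_tree_in_def subgraph_of_def)
  then show thesis
    using that[of "add_leaf T u v"] by auto
qed

section \<open>The upper bound: legs into \<open>D\<close> in three new colours\<close>

lemma three_distinct_elements:
  assumes "card A \<ge> 3"
  shows "\<exists>g. inj_on g {0, 1, 2 :: nat} \<and> g ` {0, 1, 2} \<subseteq> A"
proof -
  obtain B where "B \<subseteq> A" "card B = 3"
    using assms by (metis obtain_subset_with_card_n)
  then obtain x y z where "{x, y, z} \<subseteq> A" "x \<noteq> y" "x \<noteq> z" "y \<noteq> z"
    by (metis card_3_iff)
  then show ?thesis
    by (intro exI[of _ "\<lambda>i. if i = 0 then x else if i = 1 then y else z"])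
      (auto simp: inj_on_def)
qed

theorem rx3_le_connected_dominating3:
  assumes conn: "connected_graph G" and dom: "connected_dominating3 G D"
  shows "rx3 G \<le> rx3 (induced_graph G D) + 3"
proof -
  let ?H = "induced_graph G D"
  have edgesH: "edges ?H = {e \<in> edges G. e \<subseteq> D}" and vertsH: "verts ?H = D"
    by (simp_all add: induced_graph_def)
  have connH: "connected_graph ?H" and DG: "D \<subseteq> verts G"
    and three: "\<And>v. v \<in> verts G - D \<Longrightarrow> card {u \<in> D. {u, v} \<in> edges G} \<ge> 3"
    using dom by (auto simp: connected_dominating3_def dominating3_def)
  have simple: "simple_graph G"
    using conn by (simp add: connected_graph_def)
  have finD: "finite D"
    using simple DG by (auto simp: simple_graph_def intro: finite_subset)
  obtain c0 where c0: "rainbow3_coloring ?H c0" and k: "card (c0 ` edges ?H) = rx3 ?H"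
    using rx3_attained[OF connH] .
  have finE: "finite (edges ?H)"
    using finite_edges[OF simple] by (simp add: edgesH)
  \<comment> \<open>All old colours lie below \<open>M\<close>, so \<open>M\<close>,
    \<open>M + 1\<close> and \<open>M + 2\<close> are new.\<close>
  obtain M where M: "\<And>e. e \<in> edges ?H \<Longrightarrow> c0 e < M"
    using finE by (metis finite_imageI finite_nat_set_iff_bounded imageI)
  have "\<forall>v \<in> verts G - D. \<exists>g. inj_on g {0, 1, 2 :: nat} \<and>
      g ` {0, 1, 2} \<subseteq> {u \<in> D. {u, v} \<in> edges G}"
    using three by (intro ballI three_distinct_elements)
  from bchoice[OF this] obtain f where "\<forall>v \<in> verts G - D.
      inj_on (f v) {0, 1, 2 :: nat} \<and> f v ` {0, 1, 2} \<subseteq> {u \<in> D. {u, v} \<in> edges G}" ..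
  note f = bspec[OF this]
  \<comment> \<open>\<open>f v\<close> lists three distinct neighbours of \<open>v\<close> in
    \<open>D\<close>; its value at \<open>i\<close> is the end of the leg of index
    \<open>i\<close>.\<close>
  define leg where "leg i e \<longleftrightarrow> (\<exists>v \<in> verts G - D. e = {f v i, v})" for i e
  \<comment> \<open>The default offset 0 covers the legs of index 0 and also every edge outside
    \<open>G[D]\<close> that is no leg, so no fourth new colour arises.\<close>
  define c where "c e = (if e \<subseteq> D then c0 e
    else M + (if leg 1 e then 1 else if leg 2 e then 2 else 0))" for e
  have leg_color: "c {f v i, v} = M + i" if v: "v \<in> verts G - D" and i: "i < 3" for v i
  proof -
    have fD: "f w j \<in> D" if "w \<in> verts G - D" "j < 3" for w j
    proof -
      have "j \<in> {0, 1, 2}"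
        using that(2) by auto
      then show ?thesis
        using f[OF that(1)] by blast
    qed
    \<comment> \<open>An edge is a leg of at most one index: its end outside \<open>D\<close>
      determines \<open>v\<close>, and \<open>f v\<close> is injective.\<close>
    have "leg j {f v i, v} \<longleftrightarrow> j = i" if j: "j < 3" for j
    proof
      assume "leg j {f v i, v}"
      then obtain w where w: "w \<in> verts G - D" "{f v i, v} = {f w j, w}"
        by (auto simp: leg_def)
      then have "w = v" "f v i = f v j"
        using fD[OF v i] fD[OF w(1) j] v by (auto simp: doubleton_eq_iff)
      moreover have "i \<in> {0, 1, 2}" "j \<in> {0, 1, 2}"
        using i j by auto
      ultimately show "j = i"
        using inj_on_eq_iff[OF conjunct1[OF f[OF v]], of i j] by simp
    next
      assume "j = i"
      then show "leg j {f v i, v}"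
        using v unfolding leg_def by blast
    qed
    then show ?thesis
      using v i by (auto simp: c_def)
  qed
  have "rainbow3_coloring G c"
    unfolding rainbow3_coloring_def
  proof (intro allI impI)
    fix S assume "S \<subseteq> verts G \<and> card S = 3"
    then have SG: "S \<subseteq> verts G" and cardS: "card S = 3"
      by auto
    then obtain x y z where S: "S = {x, y, z}"
      by (metis card_3_iff)
    \<comment> \<open>Needed to enlarge the set of feet to three elements of \<open>D\<close>.
      Either \<open>S\<close> itself lies in \<open>D\<close>, or a vertex of \<open>S\<close>
      outside \<open>D\<close> has three neighbours there.\<close>
    have D3: "card D \<ge> 3"
    proof (cases "S \<subseteq> D")
      case True
      then show ?thesis
        using cardS card_mono[OF finD] by metis
    next
      case False
      then obtain v where v: "v \<in> verts G - D"
        using SG by blast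
      have "card {u \<in> D. {u, v} \<in> edges G} \<le> card D"
        using finD by (auto intro: card_mono)
      then show ?thesis
        using three[OF v] by linarith
    qed
    \<comment> \<open>A vertex of \<open>D\<close> is its own foot and needs no leg.\<close>
    define foot where "foot w i = (if w \<in> D then w else f w i)" for w i
    have footD: "foot w i \<in> D" if "w \<in> S" "i \<in> {0, 1, 2}" for w i
      using f[of w] that SG by (auto simp: foot_def)
    let ?F = "{foot x 0, foot y 1, foot z 2}"
    have "?F \<subseteq> D"
      using footD by (simp add: S)
    moreover have "card ?F \<le> 3"
      using card_insert_le_m1 by (simp add: card_insert_if)
    \<comment> \<open>Feet may coincide, while the colouring \<open>c0\<close> only speaks of sets
      of exactly three vertices; hence the enlargement from \<open>?F\<close> to
      \<open>F\<close>.\<close>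
    ultimately obtain F where F: "?F \<subseteq> F" "F \<subseteq> D" "card F = 3"
      using exists_subset_between[of ?F 3 D] D3 finD by blast
    then obtain T0 where T0: "rainbow_tree_in ?H c0 T0" and FT: "F \<subseteq> verts T0"
      using c0 unfolding rainbow3_coloring_def vertsH by blast
    have eT0: "edges T0 \<subseteq> edges ?H" and vT0: "verts T0 \<subseteq> D"
      using T0 by (auto simp: rainbow_tree_in_def subgraph_of_def vertsH)
    have cc0: "c e = c0 e" if "e \<in> edges T0" for e
      using that eT0 by (auto simp: c_def edgesH)
    then have "inj_on c (edges T0)"
      using T0 inj_on_cong[of "edges T0" c c0] by (auto simp: rainbow_tree_in_def)
    then have T0c: "rainbow_tree_in G c T0"
      using T0 DG eT0 by (auto simp: rainbow_tree_in_def subgraph_of_def vertsH edgesH)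
    have col0: "c ` edges T0 \<subseteq> {..<M}"
      using cc0 eT0 M by auto
    \<comment> \<open>The invariant is that all colours stay below \<open>M + i\<close> before index
      \<open>i\<close> is treated. The leg of colour \<open>M + i\<close> is then new to the tree,
      and the bound grows by one.\<close>
    have step: "\<exists>T'. rainbow_tree_in G c T' \<and> insert w (verts T) \<subseteq> verts T' \<and>
        c ` edges T' \<subseteq> {..<Suc (M + i)}"
      if T: "rainbow_tree_in G c T" and col: "c ` edges T \<subseteq> {..<M + i}"
        and w: "w \<in> S" and i: "i \<in> {0, 1, 2}" and foot: "foot w i \<in> verts T" for T w i
    proof (cases "w \<in> D")
      case True
      moreover have "c ` edges T \<subseteq> {..<Suc (M + i)}"
        using col by auto
      ultimately show ?thesis
        using T foot by (intro exI[of _ T]) (auto simp: foot_def)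
    next
      case False
      then have wD: "w \<in> verts G - D"
        using w SG by blast
      have fT: "f w i \<in> verts T" and fe: "{f w i, w} \<in> edges G"
        using False foot f[OF wD] i by (auto simp: foot_def)
      have fc: "c {f w i, w} = M + i"
        using leg_color[OF wD] i by auto
      then have "c {f w i, w} \<notin> c ` edges T"
        using col by auto
      then obtain T' where T': "rainbow_tree_in G c T'" "insert w (verts T) \<subseteq> verts T'"
        "c ` edges T' \<subseteq> insert (c {f w i, w}) (c ` edges T)"
        using rainbow_tree_extend[OF T fT _ fe] wD by blast
      moreover have "c ` edges T' \<subseteq> {..<Suc (M + i)}"
        using T'(3) fc col by fastforce
      ultimately show ?thesis
        by blast
    qed
    have feet: "foot x 0 \<in> verts T0" "foot y 1 \<in> verts T0" "foot z 2 \<in> verts T0"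
      using F(1) FT by auto
    \<comment> \<open>The bound is written with \<open>M + 0\<close> so that it matches
      \<open>step\<close> at index 0.\<close>
    have "\<exists>T1. rainbow_tree_in G c T1 \<and> insert x (verts T0) \<subseteq> verts T1 \<and>
        c ` edges T1 \<subseteq> {..<Suc (M + 0)}"
      using T0c col0 feet(1) by (intro step) (simp_all add: S)
    then obtain T1 where T1: "rainbow_tree_in G c T1" "insert x (verts T0) \<subseteq> verts T1"
      "c ` edges T1 \<subseteq> {..<M + 1}"
      by auto
    have "\<exists>T2. rainbow_tree_in G c T2 \<and> insert y (verts T1) \<subseteq> verts T2 \<and>
        c ` edges T2 \<subseteq> {..<Suc (M + 1)}"
      using feet(2) T1(2) by (intro step T1(1,3)) (auto simp: S)
    then obtain T2 where T2: "rainbow_tree_in G c T2" "insert y (verts T1) \<subseteq> verts T2"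
      "c ` edges T2 \<subseteq> {..<M + 2}"
      by auto
    have "\<exists>T3. rainbow_tree_in G c T3 \<and> insert z (verts T2) \<subseteq> verts T3 \<and>
        c ` edges T3 \<subseteq> {..<Suc (M + 2)}"
      using feet(3) T1(2) T2(2) by (intro step T2(1,3)) (auto simp: S)
    then obtain T3 where T3: "rainbow_tree_in G c T3" "insert z (verts T2) \<subseteq> verts T3"
      by auto
    have "S \<subseteq> verts T3"
      using T1 T2 T3 by (auto simp: S)
    with T3 show "\<exists>T. rainbow_tree_in G c T \<and> S \<subseteq> verts T"
      by blast
  qed
  then have "rx3 G \<le> card (c ` edges G)"
    by (rule rx3_le)
  also have "\<dots> \<le> card (c0 ` edges ?H \<union> {M, M + 1, M + 2})"
  proof (rule card_mono)
    have "c e \<in> c0 ` edges ?H \<union> {M, M + 1, M + 2}" if "e \<in> edges G" for e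
      using that by (cases "e \<subseteq> D") (simp_all add: c_def edgesH)
    then show "c ` edges G \<subseteq> c0 ` edges ?H \<union> {M, M + 1, M + 2}"
      by (rule image_subsetI)
  qed (use finE in simp)
  also have "\<dots> \<le> card (c0 ` edges ?H) + card {M, M + 1, M + 2}"
    by (rule card_Un_le)
  also have "\<dots> = rx3 ?H + 3"
    by (simp add: k)
  finally show ?thesis .
qed

section \<open>Tightness\<close>

text \<open>The vertices 0, 1, 2 form the triangle, and 3 to 131 are the 129 independent vertices.
  Listing each edge with its smaller end first excludes loops, and the smaller end always lies in
  the triangle.\<close>

definition triangle_join :: "nat ugraph" where
  "triangle_join = \<lparr>verts = {..<132}, edges = {{u, v} | u v. u < 3 \<and> u < v \<and> v < 132}\<rparr>"

lemma verts_triangle_join: "verts triangle_join = {..<132}"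
  and edges_triangle_join: "edges triangle_join = {{u, v} | u v. u < 3 \<and> u < v \<and> v < 132}"
  by (simp_all add: triangle_join_def)

lemma edge_triangle_join:
  "{u, v} \<in> edges triangle_join \<longleftrightarrow> u \<noteq> v \<and> u < 132 \<and> v < 132 \<and> (u < 3 \<or> v < 3)"
proof
  assume "u \<noteq> v \<and> u < 132 \<and> v < 132 \<and> (u < 3 \<or> v < 3)"
  then have "u < 3 \<and> u < v \<and> v < 132 \<or> v < 3 \<and> v < u \<and> u < 132"
    by linarith
  then show "{u, v} \<in> edges triangle_join"
    unfolding edges_triangle_join by (auto simp: insert_commute)
qed (auto simp: edges_triangle_join doubleton_eq_iff)

lemma simple_triangle_join: "simple_graph triangle_join"
  by (auto simp: simple_graph_def verts_triangle_join edges_triangle_join)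

lemma connected_triangle_join: "connected_graph triangle_join"
proof (rule connected_graphI_root[of _ 0])
  fix v assume v: "v \<in> verts triangle_join"
  show "(0, v) \<in> (adj_rel triangle_join)\<^sup>*"
  proof (cases "v = 0")
    case False
    then have "(0, v) \<in> adj_rel triangle_join"
      using v by (simp add: adj_rel_def edge_triangle_join verts_triangle_join)
    then show ?thesis ..
  qed simp
qed (simp_all add: simple_triangle_join verts_triangle_join)

lemma min_degree_triangle_join: "min_degree triangle_join \<ge> 3"
proof -
  have "vertex_degree triangle_join v \<ge> 3" if v: "v < 132" for v
  proof -
    have fin: "finite {e \<in> edges triangle_join. v \<in> e}"
      using finite_edges[OF simple_triangle_join] by simp
    obtain a b d where abd: "a \<noteq> b" "a \<noteq> d" "b \<noteq> d" "a \<noteq> v" "b \<noteq> v" "d \<noteq> v"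
      and E: "{{a, v}, {b, v}, {d, v}} \<subseteq> edges triangle_join"
    \<comment> \<open>Three neighbours of \<open>v\<close> are taken from the other side of the
      join, so they differ from \<open>v\<close>.\<close>
    proof (cases "v < 3")
      case True
      then show thesis
        using that[of 3 4 5] by (simp add: edge_triangle_join)
    next
      case False
      then show thesis
        using that[of 0 1 2] v by (simp add: edge_triangle_join)
    qed
    have "card {{a, v}, {b, v}, {d, v}} = 3"
      using abd by (auto simp: doubleton_eq_iff card_insert_if)
    moreover have "card {{a, v}, {b, v}, {d, v}} \<le> vertex_degree triangle_join v"
      unfolding vertex_degree_def using E fin by (intro card_mono) auto
    ultimately show ?thesis
      by simp
  qed
  moreover have "{..<132 :: nat} \<noteq> {}"
    by (metis lessThan_iff empty_iff zero_less_numeral)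
  ultimately show ?thesis
    unfolding min_degree_def verts_triangle_join
    by (subst Min_ge_iff) auto
qed

lemma connected_dominating3_triangle_join: "connected_dominating3 triangle_join {0, 1, 2}"
proof -
  let ?H = "induced_graph triangle_join {0, 1, 2}"
  have "connected_graph ?H"
  proof (rule connected_graphI_root[of _ 0])
    show "simple_graph ?H"
      using simple_triangle_join by (auto simp: simple_graph_def induced_graph_def)
    fix v assume "v \<in> verts ?H"
    then have "v = 0 \<or> (0, v) \<in> adj_rel ?H"
      by (auto simp: induced_graph_def adj_rel_def edge_triangle_join)
    then show "(0, v) \<in> (adj_rel ?H)\<^sup>*"
      by auto
  qed (simp add: induced_graph_def)
  moreover have "card {u \<in> {0, 1, 2}. {u, v} \<in> edges triangle_join} \<ge> 3"
    if "v \<in> verts triangle_join - {0, 1, 2}" for v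
  proof -
    have "{u \<in> {0, 1, 2}. {u, v} \<in> edges triangle_join} = {0, 1, 2}"
      using that by (auto simp: edge_triangle_join verts_triangle_join)
    then show ?thesis
      by simp
  qed
  ultimately show ?thesis
    by (auto simp: connected_dominating3_def dominating3_def verts_triangle_join)
qed

text \<open>The triangle has a single 3-set of vertices, so one rainbow path 0-1-2 is enough. The
  two remaining edges may share a colour.\<close>

lemma rx3_triangle: "rx3 (induced_graph triangle_join {0, 1, 2}) \<le> 2"
proof -
  let ?H = "induced_graph triangle_join {0, 1, 2}"
  define c :: "nat set \<Rightarrow> nat" where "c e = (if e = {0, 1} then 0 else 1)" for e
  let ?T = "add_leaf (add_leaf \<lparr>verts = {0 :: nat}, edges = {}\<rparr> 0 1) 1 2"
  have "tree_graph ?T"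
    by (intro tree_add_leaf tree_singleton) simp_all
  moreover have "inj_on c (edges ?T)"
    by (auto simp: c_def inj_on_def doubleton_eq_iff)
  moreover have "subgraph_of ?T ?H"
    using \<open>tree_graph ?T\<close> unfolding subgraph_of_def tree_graph_def connected_graph_def
    by (auto simp: induced_graph_def edge_triangle_join)
  ultimately have T: "rainbow_tree_in ?H c ?T"
    by (simp add: rainbow_tree_in_def)
  have "{0, 1, 2} \<subseteq> verts ?T"
    by auto
  then have "rainbow3_coloring ?H c"
    unfolding rainbow3_coloring_def
    using T by (auto simp: induced_graph_def intro!: exI[of _ ?T])
  then have "rx3 ?H \<le> card (c ` edges ?H)"
    by (rule rx3_le)
  also have "\<dots> \<le> card {0, 1 :: nat}"
    by (intro card_mono) (auto simp: c_def)
  finally show ?thesis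
    by simp
qed

section \<open>The lower bound: independent vertices with equal colour triples\<close>

lemma pigeonhole_three:
  assumes "g ` A \<subseteq> B" and "finite B" and "card A > 2 * card B"
  shows "\<exists>b \<in> B. card {a \<in> A. g a = b} \<ge> 3"
proof (rule ccontr)
  assume "\<not> ?thesis"
  then have le: "card {a \<in> A. g a = b} \<le> 2" if "b \<in> B" for b
    using that by fastforce
  have "A = (\<Union>b \<in> B. {a \<in> A. g a = b})"
    using assms(1) by auto
  then have "card A \<le> (\<Sum>b \<in> B. card {a \<in> A. g a = b})"
    using card_UN_le[OF assms(2)] by metis
  also have "\<dots> \<le> (\<Sum>b \<in> B. 2)"
    using le by (rule sum_mono)
  also have "\<dots> = 2 * card B"
    by simp
  finally show False
    using assms(3) by simp
qed

lemma connected_vertex_edge: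
  assumes "connected_graph G" and x: "x \<in> verts G" and y: "y \<in> verts G" and "x \<noteq> y"
  shows "\<exists>u. {u, x} \<in> edges G"
proof -
  have "(y, x) \<in> (adj_rel G)\<^sup>*"
    using assms by (auto simp: connected_graph_def)
  then obtain u where "(u, x) \<in> adj_rel G"
    using \<open>x \<noteq> y\<close> by (metis rtranclE)
  then show ?thesis
    by (auto simp: adj_rel_def)
qed

lemma rx3_triangle_join: "rx3 triangle_join \<ge> 5"
proof -
  let ?G = triangle_join
  obtain c where c: "rainbow3_coloring ?G c" and k: "card (c ` edges ?G) = rx3 ?G"
    using rx3_attained[OF connected_triangle_join] .
  let ?C = "c ` edges ?G"
  have finC: "finite ?C"
    using finite_edges[OF simple_triangle_join] by simp
  show ?thesis
  proof (rule ccontr)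
    assume "\<not> ?thesis"
    then have C4: "card ?C \<le> 4"
      using k by simp
    define g where "g v = (c {0, v}, c {1, v}, c {2, v})" for v
    \<comment> \<open>There are at most 64 colour triples for 129 vertices, and 129 exceeds twice
      64.\<close>
    have "card (?C \<times> ?C \<times> ?C) \<le> 4 * (4 * 4)"
      unfolding card_cartesian_product using C4 by (intro mult_le_mono)
    then have "card {3..<132 :: nat} > 2 * card (?C \<times> ?C \<times> ?C)"
      by simp
    moreover have "g ` {3..<132} \<subseteq> ?C \<times> ?C \<times> ?C"
      unfolding g_def by (auto intro!: imageI simp: edge_triangle_join)
    ultimately obtain b where "card {v \<in> {3..<132}. g v = b} \<ge> 3"
      using pigeonhole_three[of g "{3..<132}" "?C \<times> ?C \<times> ?C"] finC by auto
    then obtain S where S: "S \<subseteq> {v \<in> {3..<132}. g v = b}" "card S = 3"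
      by (rule obtain_subset_with_card_n)
    have "S \<subseteq> verts ?G"
      using S(1) by (auto simp: verts_triangle_join)
    then obtain T where T: "rainbow_tree_in ?G c T" and ST: "S \<subseteq> verts T"
      using c S(2) unfolding rainbow3_coloring_def by blast
    have sT: "simple_graph T" and eT: "edges T \<subseteq> edges ?G" and inj: "inj_on c (edges T)"
      and conT: "connected_graph T"
      using T by (auto simp: rainbow_tree_in_def subgraph_of_def tree_graph_def)
    have "\<exists>u. {u, x} \<in> edges T" if x: "x \<in> S" for x
    proof -
      obtain y where "y \<in> S" "y \<noteq> x"
        using S(2) by (auto simp: card_3_iff)
      then show ?thesis
        using connected_vertex_edge[OF conT, of x y] x ST by auto
    qed
    then obtain u where u: "\<And>x. x \<in> S \<Longrightarrow> {u x, x} \<in> edges T"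
      by metis
    \<comment> \<open>No edge joins two vertices from 3 upwards, so the tree neighbour
      \<open>u x\<close> lies in the triangle.\<close>
    have u3: "u x < 3" if "x \<in> S" for x
      using u[OF that] eT S(1) that edge_triangle_join[of "u x" x] by fastforce
    have color: "c {i, x} = c {i, y}" if "x \<in> S" "y \<in> S" "i < 3" for i x y
    proof -
      have "g x = g y"
        using S(1) that by auto
      moreover have "i = 0 \<or> i = 1 \<or> i = 2"
        using that(3) by linarith
      ultimately show ?thesis
        by (auto simp: g_def)
    qed
    \<comment> \<open>If \<open>x\<close> and \<open>y\<close> shared the neighbour
      \<open>u x\<close>, their tree edges would have the same colour, since
      \<open>g x = g y\<close>. In a rainbow tree these edges then coincide.\<close>
    have "inj_on u S"
    proof (rule inj_onI)
      fix x y assume xy: "x \<in> S" "y \<in> S" "u x = u y"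
      then have "c {u x, x} = c {u y, y}"
        using color u3 by metis
      then have "{u x, x} = {u y, y}"
        using inj u xy by (meson inj_onD)
      then show "x = y"
        using xy(3) by (auto simp: doubleton_eq_iff)
    qed
    then have "card (u ` S) = 3"
      using S(2) by (simp add: card_image)
    moreover have "u ` S \<inter> S = {}"
      using u3 S(1) by fastforce
    moreover have finS: "finite S"
      using S(2) card.infinite by fastforce
    ultimately have "card (u ` S \<union> S) = 6"
      using S(2) by (simp add: card_Un_disjoint)
    moreover have "u ` S \<union> S \<subseteq> verts T"
      using u ST sT unfolding simple_graph_def by blast
    moreover have "finite (verts T)"
      using sT by (simp add: simple_graph_def)
    ultimately have "6 \<le> card (verts T)"
      by (metis card_mono)
    then have "5 \<le> card (edges T)"
      using connected_card_le[OF conT] by simp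
    also have "\<dots> = card (c ` edges T)"
      using inj by (simp add: card_image)
    also have "\<dots> \<le> card ?C"
      using eT finC by (intro card_mono) auto
    finally show False
      using C4 by simp
  qed
qed

theorem theorem9:
  "(\<forall>(G :: 'a ugraph) D.
      connected_graph G \<and> min_degree G \<ge> 3 \<and> connected_dominating3 G D \<longrightarrow>
      rx3 G \<le> rx3 (induced_graph G D) + 3) \<and>
   (\<exists>(G :: nat ugraph) D.
      connected_graph G \<and> min_degree G \<ge> 3 \<and> connected_dominating3 G D \<and>
      rx3 G = rx3 (induced_graph G D) + 3)"
proof (rule conjI)
  show "\<forall>(G :: 'a ugraph) D.
      connected_graph G \<and> min_degree G \<ge> 3 \<and> connected_dominating3 G D \<longrightarrow>
      rx3 G \<le> rx3 (induced_graph G D) + 3"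
  proof (intro allI impI)
    fix G :: "'a ugraph" and D
    assume *: "connected_graph G \<and> min_degree G \<ge> 3 \<and> connected_dominating3 G D"
    show "rx3 G \<le> rx3 (induced_graph G D) + 3"
      by (rule rx3_le_connected_dominating3[OF conjunct1[OF *] conjunct2[OF conjunct2[OF *]]])
  qed
next
  have "rx3 triangle_join \<le> rx3 (induced_graph triangle_join {0, 1, 2}) + 3"
    by (rule rx3_le_connected_dominating3)
      (fact connected_triangle_join connected_dominating3_triangle_join)+
  \<comment> \<open>The chain 5 <= \<open>rx3 triangle_join\<close> <= \<open>rx3\<close> of the
    triangle + 3 <= 5 collapses to equalities, so no separate lower bound for the triangle is
    required.\<close>
  then have "rx3 triangle_join = rx3 (induced_graph triangle_join {0, 1, 2}) + 3"
    using rx3_triangle rx3_triangle_join by linarith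
  then show "\<exists>(G :: nat ugraph) D.
      connected_graph G \<and> min_degree G \<ge> 3 \<and> connected_dominating3 G D \<and>
      rx3 G = rx3 (induced_graph G D) + 3"
    by (intro exI[of _ triangle_join] exI[of _ "{0, 1, 2}"] conjI
        connected_triangle_join min_degree_triangle_join connected_dominating3_triangle_join)
qed

end
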